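(* Let $R>0$ and let $\mathcal M \subseteq \mathbb{R}^{n \times p}$ be a compact $R$-proximally smooth manifold. Suppose that $h : \mathbb R^{n \times p} \to \mathbb R$ is $\tau$-weakly convex for some $\tau \in \mathbb{R}$. Then, for any bounded convex neighborhood $\mathcal U$ that contains $\mathcal M$, there exists a constant $L > 0$ such that $h$ is $L$-Lipschitz continuous on $\mathcal U$. Moreover, for any $X, Y \in \mathcal M$, any $\widetilde \nabla h(X) \in \partial h(X)$, and $\widetilde \nabla_{\mathcal M}h(X) = \mathcal P_{T_X \mathcal M}(\widetilde \nabla h(X)) \in \partial_{\mathcal M}h(X)$, we have $$h(Y) \geq h(X) + \langle \widetilde \nabla_{\mathcal M} h(X), Y - X\rangle - \tfrac{\tau + \|\widetilde\nabla h(X)\|/R}{2}\,\|Y-X\|^2 \geq h(X) + \langle \widetilde \nabla_{\mathcal M} h(X), Y - X\rangle - \tfrac{\tau + L/R}{2}\,\|Y-X\|^2 .$$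
   Context: $\mathbb{R}^{n\times p}$ carries the Frobenius inner product $\langle\xi,\eta\rangle=\mathrm{tr}(\xi^\top\eta)$ and norm $\|\cdot\|$. A function $h$ is $\tau$-weakly convex if $h(\cdot)+\frac\tau2\|\cdot\|^2$ is convex ($\tau<0$ is allowed, and then $h$ is strongly convex). $\mathcal M$ is a smooth embedded submanifold of $\mathbb{R}^{n\times p}$, $T_X\mathcal M$ its tangent space at $X$. A closed set $\mathcal S\subseteq\mathbb{R}^{n\times p}$ is $R$-proximally smooth if the nearest-point projection $\mathcal P_{\mathcal S}(X)=\{Y\in\mathcal S:\|X-Y\|=\mathrm{dist}(X,\mathcal S)\}$ is a singleton whenever $\mathrm{dist}(X,\mathcal S)<R$. $\partial h$ is the Clarke subdifferential, and the Riemannian Clarke subdifferential is $\partial_{\mathcal M}h(X)=\{\mathcal P_{T_X\mathcal M}(G):G\in\partial h(X)\}$. *)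

theory Defs
  imports "HOL-Analysis.Analysis"
begin

text \<open>Matrices with \<open>n\<close> rows and \<open>p\<close> columns are rendered as \<open>real ^ 'p ^ 'n\<close>. The library inner
  product on this type is the Frobenius one, so \<open>norm\<close> is the Frobenius norm.\<close>

lemma frobenius_inner:
  fixes A B :: "real ^ 'p ^ 'n"
  shows "A \<bullet> B = trace (transpose A ** B)"
proof -
  have "A \<bullet> B = (\<Sum>i\<in>UNIV. \<Sum>j\<in>UNIV. A $ i $ j * B $ i $ j)"
    by (simp add: inner_vec_def)
  also have "\<dots> = (\<Sum>j\<in>UNIV. \<Sum>i\<in>UNIV. A $ i $ j * B $ i $ j)"
    by (rule sum.swap)
  also have "\<dots> = trace (transpose A ** B)"
    by (simp add: trace_def matrix_matrix_mult_def transpose_def)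
  finally show ?thesis .
qed

definition weakly_convex :: "real \<Rightarrow> ('a::real_normed_vector \<Rightarrow> real) \<Rightarrow> bool" where
  "weakly_convex \<tau> h \<longleftrightarrow> convex_on UNIV (\<lambda>x. h x + \<tau> / 2 * (norm x)\<^sup>2)"

text \<open>\<open>C\<^sup>k\<close> maps on an open set: all iterated directional derivatives up to order \<open>k\<close> exist (as
  Frechet derivatives) and are continuous.\<close>

fun Ck_on :: "nat \<Rightarrow> 'a::euclidean_space set \<Rightarrow> ('a \<Rightarrow> 'b::euclidean_space) \<Rightarrow> bool" where
  "Ck_on 0 S f \<longleftrightarrow> continuous_on S f"
| "Ck_on (Suc k) S f \<longleftrightarrow>
     (\<forall>x\<in>S. f differentiable (at x)) \<and> (\<forall>v. Ck_on k S (\<lambda>x. frechet_derivative f (at x) v))"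

definition smooth_on :: "'a::euclidean_space set \<Rightarrow> ('a \<Rightarrow> 'b::euclidean_space) \<Rightarrow> bool" where
  "smooth_on S f \<longleftrightarrow> open S \<and> (\<forall>k. Ck_on k S f)"

text \<open>Smooth embedded submanifolds (without boundary, of some constant dimension \<open>d\<close>), via slice
  charts: around each point a diffeomorphism \<open>\<phi>\<close> between open sets, with inverse \<open>\<psi>\<close>, flattens
  \<open>M\<close> to an open piece of a \<open>d\<close>-dimensional linear subspace \<open>E\<close>.\<close>

definition embedded_submanifold :: "'a::euclidean_space set \<Rightarrow> bool" where
  "embedded_submanifold M \<longleftrightarrow>
     (\<exists>d. \<forall>x\<in>M. \<exists>U V (E :: 'a set) (\<phi> :: 'a \<Rightarrow> 'a) \<psi>.
        x \<in> U \<and> smooth_on U \<phi> \<and> smooth_on V \<psi> \<and> homeomorphism U V \<phi> \<psi> \<and>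
        subspace E \<and> dim E = d \<and> \<phi> ` (M \<inter> U) = E \<inter> V)"

text \<open>Velocities at \<open>x\<close> of smooth curves in \<open>M\<close> through \<open>x\<close>.\<close>

definition tangent_space :: "'a::euclidean_space set \<Rightarrow> 'a \<Rightarrow> 'a set" where
  "tangent_space M x =
     {v. \<exists>\<epsilon>>0. \<exists>\<gamma> :: real \<Rightarrow> 'a. smooth_on {-\<epsilon><..<\<epsilon>} \<gamma> \<and> \<gamma> ` {-\<epsilon><..<\<epsilon>} \<subseteq> M \<and>
         \<gamma> 0 = x \<and> (\<gamma> has_vector_derivative v) (at 0)}"

definition nearest_points :: "'a::euclidean_space set \<Rightarrow> 'a \<Rightarrow> 'a set" where
  "nearest_points S x = {y \<in> S. norm (x - y) = infdist x S}"

text \<open>The guard \<open>S \<noteq> {}\<close> is there because \<open>infdist x {} = 0\<close>, whereas mathematically the distance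
  to the empty set is infinite.\<close>

definition proximally_smooth :: "real \<Rightarrow> 'a::euclidean_space set \<Rightarrow> bool" where
  "proximally_smooth R S \<longleftrightarrow>
     closed S \<and> (\<forall>x. S \<noteq> {} \<and> infdist x S < R \<longrightarrow> is_singleton (nearest_points S x))"

text \<open>Clarke's generalized directional derivative
  \<open>h\<degree>(x; v) = limsup (h (y + t v) - h y) / t\<close> as \<open>y \<rightarrow> x\<close> and \<open>t \<down> 0\<close>. It is taken in the extended
  reals so that it is meaningful for arbitrary \<open>h\<close>; it is finite if \<open>h\<close> is Lipschitz near \<open>x\<close>.\<close>

definition clarke_derivative :: "('a::euclidean_space \<Rightarrow> real) \<Rightarrow> 'a \<Rightarrow> 'a \<Rightarrow> ereal" where
  "clarke_derivative h x v =
     Limsup (nhds x \<times>\<^sub>F at_right 0) (\<lambda>(y, t). ereal ((h (y + t *\<^sub>R v) - h y) / t))"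

definition clarke_subdifferential :: "('a::euclidean_space \<Rightarrow> real) \<Rightarrow> 'a \<Rightarrow> 'a set" where
  "clarke_subdifferential h x = {g. \<forall>v. ereal (g \<bullet> v) \<le> clarke_derivative h x v}"

definition riemannian_clarke_subdifferential ::
    "'a::euclidean_space set \<Rightarrow> ('a \<Rightarrow> real) \<Rightarrow> 'a \<Rightarrow> 'a set" where
  "riemannian_clarke_subdifferential M h x =
     closest_point (tangent_space M x) ` clarke_subdifferential h x"

end

theory Submission
  imports Defs
begin

text \<open>A Clarke subgradient \<open>G\<close> of the weakly convex \<open>h\<close> at \<open>X\<close> satisfies
  \<open>h Y \<ge> h X + G \<bullet> (Y - X) - \<tau> / 2 \<parallel>Y - X\<parallel>\<^sup>2\<close>, so only the normal part \<open>W\<close> of \<open>G\<close> at \<open>X\<close> is left to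
  control, by \<open>\<bar>W \<bullet> (Y - X)\<bar> \<le> \<parallel>W\<parallel> / (2 R) \<parallel>Y - X\<parallel>\<^sup>2\<close>. Taylor's formula in a chart gives such a bound
  with some constant in place of \<open>1 / (2 R)\<close>; in other words, \<open>X\<close> is a nearest point of \<open>M\<close> to \<open>X + t N\<close>
  for the unit normal \<open>N = W / \<parallel>W\<parallel>\<close> and some \<open>t > 0\<close>. Uniqueness of nearest points within distance
  \<open>R\<close> and Brouwer's fixed point theorem extend this to all \<open>t < R\<close>, and \<open>t \<rightarrow> R\<close> yields the constant.\<close>

subsection \<open>Weakly convex functions and Clarke subgradients\<close>

text \<open>Continuity bounds \<open>f\<close> on the ball with radius one larger. The segment from
  \<open>x\<close> to \<open>y\<close> can be prolonged by one unit inside that ball, and convexity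
  bounds the rise up to \<open>y\<close> by the share of the rise over the prolonged
  segment.\<close>

lemma convex_on_lipschitz_cball:
  fixes f :: "'a::euclidean_space \<Rightarrow> real"
  assumes "convex_on UNIV f"
  shows "\<exists>L. L-lipschitz_on (cball 0 r) f"
proof -
  have "continuous_on UNIV f"
    using assms convex_on_continuous by blast
  then have "compact (f ` cball 0 (r + 1))"
    by (intro compact_continuous_image) (auto intro: continuous_on_subset)
  then obtain B where B: "\<And>x. x \<in> cball 0 (r + 1) \<Longrightarrow> \<bar>f x\<bar> \<le> B"
    by (force dest!: compact_imp_bounded simp: bounded_iff)
  have le: "f y - f x \<le> 2 * \<bar>B\<bar> * norm (y - x)" if "x \<in> cball 0 r" "y \<in> cball 0 r" for x y
  proof (cases "x = y")
    case False
    define d where "d = norm (y - x)"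
    \<comment> \<open>\<open>z\<close> lies one unit beyond \<open>y\<close>, so \<open>y\<close>
      divides the segment from \<open>x\<close> to \<open>z\<close>, of length \<open>1 + d\<close>,
      at this parameter.\<close>
    define u where "u = d / (1 + d)"
    define z where "z = y + (1 / d) *\<^sub>R (y - x)"
    have d: "d > 0" using False by (simp add: d_def)
    have u: "0 \<le> u" "u \<le> 1" "u \<le> d"
      using d by (auto simp: u_def field_simps)
    have "norm z \<le> norm y + 1"
      unfolding z_def using d by (intro norm_triangle_le) (simp add: d_def)
    then have z: "\<bar>f z\<bar> \<le> \<bar>B\<bar>" using that B[of z] by auto
    have x: "\<bar>f x\<bar> \<le> \<bar>B\<bar>" using that B[of x] by auto
    have "(1 - u) *\<^sub>R x + u *\<^sub>R z = x + (u + u / d) *\<^sub>R (y - x)"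
      by (simp add: z_def algebra_simps)
    also have "u + u / d = u * (1 + d) / d" using d by (simp add: field_simps)
    also have "\<dots> = 1" using d by (simp add: u_def)
    finally have "y = (1 - u) *\<^sub>R x + u *\<^sub>R z" by simp
    then have "f y \<le> (1 - u) * f x + u * f z"
      using convex_onD[OF assms, of u x z] u by auto
    then have "f y - f x \<le> u * (f z - f x)" by (simp add: algebra_simps)
    also have "\<dots> \<le> u * (2 * \<bar>B\<bar>)"
      using x z u by (intro mult_left_mono) auto
    also have "\<dots> \<le> d * (2 * \<bar>B\<bar>)"
      using u by (intro mult_right_mono) auto
    finally show ?thesis by (simp add: d_def mult_ac)
  qed auto
  have "(2 * \<bar>B\<bar>)-lipschitz_on (cball 0 r) f"
  proof (rule lipschitz_onI)
    fix x y :: 'a assume "x \<in> cball 0 r" "y \<in> cball 0 r"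
    then show "dist (f x) (f y) \<le> 2 * \<bar>B\<bar> * dist x y"
      using le[of x y] le[of y x] by (simp add: dist_norm norm_minus_commute abs_le_iff)
  qed simp
  then show ?thesis ..
qed

lemma lipschitz_on_norm_power2:
  assumes "r \<ge> 0"
  shows "(2 * r)-lipschitz_on (cball 0 r) (\<lambda>x::'a::real_normed_vector. (norm x)\<^sup>2)"
proof (rule lipschitz_onI)
  fix x y :: 'a assume xy: "x \<in> cball 0 r" "y \<in> cball 0 r"
  have "dist ((norm x)\<^sup>2) ((norm y)\<^sup>2) = \<bar>norm x + norm y\<bar> * \<bar>norm x - norm y\<bar>"
    by (simp add: dist_real_def power2_eq_square square_diff_square_factored abs_mult)
  also have "\<dots> \<le> (2 * r) * dist x y"
    using xy norm_triangle_ineq3[of x y] assms by (intro mult_mono) (auto simp: dist_norm)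
  finally show "dist ((norm x)\<^sup>2) ((norm y)\<^sup>2) \<le> 2 * r * dist x y" .
qed (use assms in simp)

lemma weakly_convex_lipschitz_on_bounded:
  fixes h :: "'a::euclidean_space \<Rightarrow> real"
  assumes "weakly_convex \<tau> h" "bounded U"
  shows "\<exists>L>0. L-lipschitz_on U h"
proof -
  obtain r where r: "U \<subseteq> cball 0 r" "r > 0"
    using bounded_subset_ballD[OF assms(2), of 0] ball_subset_cball by blast
  obtain L where "L-lipschitz_on (cball 0 r) (\<lambda>x. h x + \<tau> / 2 * (norm x)\<^sup>2)"
    using convex_on_lipschitz_cball assms(1) unfolding weakly_convex_def by blast
  moreover have "(2 * r)-lipschitz_on (cball 0 r) (\<lambda>x::'a. (norm x)\<^sup>2)"
    by (rule lipschitz_on_norm_power2) (use r in simp)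
  then have "(\<bar>\<tau> / 2\<bar> * (2 * r))-lipschitz_on (cball 0 r) (\<lambda>x::'a. \<tau> / 2 * (norm x)\<^sup>2)"
    by (rule lipschitz_on_cmult_real)
  ultimately have "(L + \<bar>\<tau> / 2\<bar> * (2 * r))-lipschitz_on (cball 0 r)
      (\<lambda>x. (h x + \<tau> / 2 * (norm x)\<^sup>2) - \<tau> / 2 * (norm x)\<^sup>2)"
    by (rule lipschitz_on_diff)
  then have L': "(L + \<bar>\<tau> / 2\<bar> * (2 * r))-lipschitz_on U h"
    using r(1) by (auto intro: lipschitz_on_subset)
  \<comment> \<open>The constant found so far may be 0; adding 1 makes it positive.\<close>
  then have "(L + \<bar>\<tau> / 2\<bar> * (2 * r) + 1)-lipschitz_on U h"
    by (rule lipschitz_on_mono) auto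
  with lipschitz_on_nonneg[OF L'] show ?thesis
    by (intro exI[of _ "L + \<bar>\<tau> / 2\<bar> * (2 * r) + 1"]) auto
qed

lemma eventually_prod_filter_splitI:
  assumes "eventually P F" "eventually Q G"
  shows "\<forall>\<^sub>F (y, t) in F \<times>\<^sub>F G. P y \<and> Q t"
  using assms unfolding eventually_prod_filter by auto

text \<open>Testing the subgradient inequality in the direction \<open>g\<close> itself gives
  \<open>g \<bullet> g \<le> L * norm g\<close>. Interiority of \<open>x\<close> keeps both points
  of the difference quotient in \<open>U\<close>.\<close>

lemma norm_clarke_subgradient_le:
  assumes "L-lipschitz_on U h" "x \<in> interior U" "g \<in> clarke_subdifferential h x"
  shows "norm g \<le> L"
proof -
  note L = lipschitz_on_nonneg[OF assms(1)]
  have "((\<lambda>(y, t). y + t *\<^sub>R g) \<longlongrightarrow> x + 0 *\<^sub>R g) (nhds x \<times>\<^sub>F at_right (0::real))"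
    unfolding case_prod_unfold
    by (intro tendsto_intros filterlim_fst filterlim_mono[OF filterlim_snd _ order_refl])
       (simp add: at_within_def)
  then have "\<forall>\<^sub>F (y, t) in nhds x \<times>\<^sub>F at_right (0::real). y + t *\<^sub>R g \<in> interior U"
    using topological_tendstoD[of _ x _ "interior U"] assms(2) by (auto simp: case_prod_unfold)
  moreover have "\<forall>\<^sub>F (y, t) in nhds x \<times>\<^sub>F at_right (0::real). y \<in> interior U \<and> t > 0"
    using assms(2) by (intro eventually_prod_filter_splitI eventually_at_right_less
        eventually_nhds_in_open) auto
  ultimately have "\<forall>\<^sub>F (y, t) in nhds x \<times>\<^sub>F at_right 0.
      ereal ((h (y + t *\<^sub>R g) - h y) / t) \<le> ereal (L * norm g)"
  proof eventually_elim
    case (elim p)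
    obtain y t where p: "p = (y, t)" by (cases p)
    have "h (y + t *\<^sub>R g) - h y \<le> L * (t * norm g)"
      using lipschitz_onD[OF assms(1), of "y + t *\<^sub>R g" y] elim interior_subset[of U]
      by (simp add: p dist_norm subset_iff abs_le_iff)
    then show ?case using elim by (simp add: p field_simps)
  qed
  then have "clarke_derivative h x g \<le> ereal (L * norm g)"
    unfolding clarke_derivative_def by (intro Limsup_bounded) (simp add: case_prod_unfold)
  moreover have "ereal (g \<bullet> g) \<le> clarke_derivative h x g"
    using assms(3) by (simp add: clarke_subdifferential_def)
  ultimately have "ereal (g \<bullet> g) \<le> ereal (L * norm g)" by (rule order_trans[rotated])
  then have "norm g * norm g \<le> L * norm g"
    by (simp add: dot_square_norm power2_eq_square)
  then show ?thesis using L by (cases "g = 0") auto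
qed

text \<open>For the convex function \<open>f\<close>, a difference quotient with step below 1 is at
  most the one with step 1. Removing the quadratic term yields a bound on the quotients of
  \<open>h\<close> that is continuous in the base point and the step, so it survives the
  limsup.\<close>

lemma weakly_convex_clarke_subgradient:
  fixes h :: "'a::euclidean_space \<Rightarrow> real"
  assumes "weakly_convex \<tau> h" "g \<in> clarke_subdifferential h x"
  shows "h y \<ge> h x + g \<bullet> (y - x) - \<tau> / 2 * (norm (y - x))\<^sup>2"
proof -
  define f where "f = (\<lambda>x. h x + \<tau> / 2 * (norm x)\<^sup>2)"
  define v where "v = y - x"
  have cvx: "convex_on UNIV f" using assms(1) by (simp add: f_def weakly_convex_def)
  have cont: "isCont f z" for z
    using convex_on_continuous[OF open_UNIV cvx] by (simp add: continuous_on_eq_continuous_at)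
  \<comment> \<open>The step-1 increment of \<open>f\<close> minus the exact difference quotient of
    \<open>\<tau> / 2 * (norm z)\<^sup>2\<close> at \<open>z\<close> with step
    \<open>t\<close>.\<close>
  define q where "q = (\<lambda>(z, t). f (z + v) - f z - \<tau> * (z \<bullet> v) - \<tau> / 2 * t * (norm v)\<^sup>2)"
  have z: "((\<lambda>p. fst p) \<longlongrightarrow> x) (nhds x \<times>\<^sub>F at_right (0::real))"
    by (rule filterlim_fst)
  have t: "((\<lambda>p. snd p) \<longlongrightarrow> 0) (nhds x \<times>\<^sub>F at_right (0::real))"
    by (rule filterlim_mono[OF filterlim_snd _ order_refl]) (simp add: at_within_def)
  have "(q \<longlongrightarrow> f (x + v) - f x - \<tau> * (x \<bullet> v) - \<tau> / 2 * 0 * (norm v)\<^sup>2)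
      (nhds x \<times>\<^sub>F at_right 0)"
    unfolding q_def case_prod_unfold
    by (intro tendsto_intros z t isCont_tendsto_compose[OF cont])
  then have lim: "((\<lambda>p. ereal (q p)) \<longlongrightarrow> ereal (f (x + v) - f x - \<tau> * (x \<bullet> v)))
      (nhds x \<times>\<^sub>F at_right 0)"
    by simp
  have "\<forall>\<^sub>F (z, t) in nhds x \<times>\<^sub>F at_right 0. True \<and> (0 < t \<and> t < (1::real))"
    by (intro eventually_prod_filter_splitI eventually_conj eventually_at_right_less
        order_tendstoD(2)[OF tendsto_ident_at]) auto
  then have "\<forall>\<^sub>F (z, t) in nhds x \<times>\<^sub>F at_right 0.
      ereal ((h (z + t *\<^sub>R v) - h z) / t) \<le> ereal (q (z, t))"
  proof eventually_elim
    case (elim p)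
    obtain z t where p: "p = (z, t)" by (cases p)
    have t: "0 < t" "t < 1" using elim p by auto
    have "(1 - t) *\<^sub>R z + t *\<^sub>R (z + v) = z + t *\<^sub>R v" by (simp add: algebra_simps)
    with convex_onD[OF cvx, of t z "z + v"] t
    have "f (z + t *\<^sub>R v) - f z \<le> t * (f (z + v) - f z)" by (simp add: algebra_simps)
    moreover have "h (z + t *\<^sub>R v) - h z =
        f (z + t *\<^sub>R v) - f z - t * (\<tau> * (z \<bullet> v) + \<tau> / 2 * t * (norm v)\<^sup>2)"
      unfolding f_def power2_norm_eq_inner
      by (simp add: inner_add_left inner_add_right inner_commute[of v z] algebra_simps)
    ultimately have "h (z + t *\<^sub>R v) - h z \<le> t * q (z, t)"
      by (simp add: q_def algebra_simps)
    then show ?case using t by (simp add: p field_simps)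
  qed
  then have "clarke_derivative h x v \<le> Limsup (nhds x \<times>\<^sub>F at_right 0) (\<lambda>p. ereal (q p))"
    unfolding clarke_derivative_def by (intro Limsup_mono) (simp add: case_prod_unfold)
  also have "\<dots> = ereal (f (x + v) - f x - \<tau> * (x \<bullet> v))"
    by (intro lim_imp_Limsup lim) (simp add: prod_filter_eq_bot)
  finally have "g \<bullet> v \<le> f (x + v) - f x - \<tau> * (x \<bullet> v)"
    using assms(2) unfolding clarke_subdifferential_def
    by (metis (mono_tags, lifting) ereal_less_eq(3) mem_Collect_eq order_trans)
  \<comment> \<open>The quadratic terms complete the square: the increment of the squared norm minus
    its linearization at \<open>x\<close> is \<open>(norm v)\<^sup>2\<close>.\<close>
  also have "\<dots> = h y - h x + \<tau> / 2 * (norm v)\<^sup>2"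
    unfolding f_def power2_norm_eq_inner v_def
    by (simp add: inner_diff_left inner_diff_right inner_commute[of x y] algebra_simps)
  finally show ?thesis by (simp add: v_def)
qed

subsection \<open>Tangent and normal vectors of embedded submanifolds\<close>

lemma has_derivative_frechet:
  "f differentiable (at x) \<Longrightarrow> (f has_derivative frechet_derivative f (at x)) (at x)"
  by (simp add: frechet_derivative_works)

lemma Ck_on_cong:
  assumes "open S" "\<And>x. x \<in> S \<Longrightarrow> f x = g x" "Ck_on k S f"
  shows "Ck_on k S g"
  using assms(2,3)
proof (induction k arbitrary: f g)
  case 0
  then show ?case using continuous_on_cong[of S S f g] by simp
next
  case (Suc k)
  have D: "(g has_derivative frechet_derivative f (at x)) (at x)" if "x \<in> S" for x
  proof (rule has_derivative_transform_within_open)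
    show "(f has_derivative frechet_derivative f (at x)) (at x)"
      using Suc.prems(2) that by (intro has_derivative_frechet) simp
  qed (use assms(1) that Suc.prems(1) in auto)
  have "Ck_on k S (\<lambda>x. frechet_derivative g (at x) v)" for v
  proof (rule Suc.IH)
    show "frechet_derivative f (at x) v = frechet_derivative g (at x) v" if "x \<in> S" for x
      using frechet_derivative_at[OF D[OF that]] by simp
    show "Ck_on k S (\<lambda>x. frechet_derivative f (at x) v)"
      using Suc.prems(2) by simp
  qed
  with D show ?case by (auto simp: differentiable_def)
qed

text \<open>The factor \<open>c\<close> keeps the claim stable under induction: a derivative in
  direction \<open>v\<close> turns \<open>c\<close> into \<open>c * v\<close> and \<open>f\<close>
  into its derivative along \<open>w\<close>. It serves to show that \<open>\<psi>\<close> maps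
  straight lines to smooth curves.\<close>

lemma Ck_on_along_line:
  fixes f :: "'a::euclidean_space \<Rightarrow> 'b::euclidean_space"
  assumes "open I" "\<And>s. s \<in> I \<Longrightarrow> a + s *\<^sub>R w \<in> S" "Ck_on k S f"
  shows "Ck_on k I (\<lambda>s::real. c *\<^sub>R f (a + s *\<^sub>R w))"
  using assms(3)
proof (induction k arbitrary: f c)
  case 0
  then have "continuous_on I (f \<circ> (\<lambda>s. a + s *\<^sub>R w))"
    using assms(2) by (intro continuous_on_compose continuous_intros)
      (auto intro: continuous_on_subset)
  then show ?case by (auto simp: o_def intro: continuous_intros)
next
  case (Suc k)
  have D: "((\<lambda>s. c *\<^sub>R f (a + s *\<^sub>R w)) has_derivative
      (\<lambda>v. (c * v) *\<^sub>R frechet_derivative f (at (a + s *\<^sub>R w)) w)) (at s)" if "s \<in> I" for s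
  proof -
    have f: "(f has_derivative frechet_derivative f (at (a + s *\<^sub>R w))) (at (a + s *\<^sub>R w))"
      using Suc.prems assms(2) that by (intro has_derivative_frechet) auto
    have "((\<lambda>s. a + s *\<^sub>R w) has_derivative (\<lambda>v. v *\<^sub>R w)) (at s)"
      by (auto intro!: derivative_eq_intros)
    from has_derivative_scaleR_right[OF has_derivative_compose[OF this f], of c]
    show ?thesis
      using linear_cmul[OF has_derivative_linear[OF f]] by simp
  qed
  have "Ck_on k I (\<lambda>s. frechet_derivative (\<lambda>s. c *\<^sub>R f (a + s *\<^sub>R w)) (at s) v)" for v
  proof (rule Ck_on_cong[OF assms(1)])
    show "Ck_on k I (\<lambda>s. (c * v) *\<^sub>R frechet_derivative f (at (a + s *\<^sub>R w)) w)"
      using Suc.prems by (intro Suc.IH) auto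
  qed (simp add: frechet_derivative_at[OF D, symmetric])
  with D show ?case by (auto simp: differentiable_def)
qed

lemma smooth_on_differentiable:
  assumes "smooth_on S f" "x \<in> S"
  shows "f differentiable (at x)"
  using assms(1)[unfolded smooth_on_def, THEN conjunct2, rule_format, of 1] assms(2) by simp

lemma smooth_on_frechet_derivative_differentiable:
  assumes "smooth_on S f" "x \<in> S"
  shows "(\<lambda>x. frechet_derivative f (at x) v) differentiable (at x)"
  using assms(1)[unfolded smooth_on_def, THEN conjunct2, rule_format, of 2] assms(2)
  by (simp add: numeral_2_eq_2)

text \<open>The difference quotients lie in \<open>E\<close>, which is closed as a
  finite-dimensional subspace.\<close>

lemma vector_derivative_in_subspace:
  fixes f :: "real \<Rightarrow> 'a::euclidean_space"
  assumes "(f has_vector_derivative w) (at a)" "subspace E" "\<forall>\<^sub>F s in nhds a. f s \<in> E"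
  shows "w \<in> E"
proof -
  have fa: "f a \<in> E" using assms(3) eventually_nhds_x_imp_x by blast
  have "\<exists>y\<in>E. dist y w < e" if "e > 0" for e
  proof -
    obtain d where d: "d > 0"
      "\<And>s. \<bar>s - a\<bar> < d \<Longrightarrow> norm (f s - f a - (s - a) *\<^sub>R w) \<le> e / 2 * \<bar>s - a\<bar>"
      using assms(1) \<open>e > 0\<close> unfolding has_vector_derivative_def has_derivative_at_alt
      by (metis half_gt_zero real_norm_def)
    have "\<forall>\<^sub>F s in at_right a. f s \<in> E \<and> s < a + d \<and> a < s"
      using assms(3) d(1)
      by (intro eventually_conj order_tendstoD(2)[OF tendsto_ident_at] eventually_at_right_less)
         (auto simp: eventually_at_filter elim: eventually_mono)
    then obtain s where s: "f s \<in> E" "s < a + d" "a < s"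
      using eventually_happens[of _ "at_right a"] by auto
    define y where "y = (1 / (s - a)) *\<^sub>R (f s - f a)"
    have "y \<in> E" using assms(2) s fa by (simp add: y_def subspace_diff subspace_scale)
    have "y - w = (1 / (s - a)) *\<^sub>R (f s - f a - (s - a) *\<^sub>R w)"
      using s by (simp add: y_def scaleR_diff_right)
    then have "dist y w = norm (f s - f a - (s - a) *\<^sub>R w) / (s - a)"
      using s by (simp add: dist_norm)
    also have "\<dots> \<le> e / 2"
      using d(2)[of s] s by (simp add: pos_divide_le_eq)
    finally have "dist y w \<le> e / 2" .
    with \<open>y \<in> E\<close> show ?thesis using \<open>e > 0\<close> by force
  qed
  then show ?thesis
    using closed_approachable[OF closed_subspace[OF assms(2)]] by blast
qed

text \<open>A curve in \<open>M\<close> is sent by \<open>\<phi>\<close> into \<open>E\<close>,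
  where its velocity stays, and \<open>\<psi>\<close> carries it back. Conversely,
  \<open>\<psi>\<close> applied to a line through \<open>\<phi> x\<close> in \<open>E\<close> is a
  curve in \<open>M\<close>.\<close>

lemma tangent_space_chart:
  fixes M :: "'a::euclidean_space set"
  assumes x: "x \<in> M" "x \<in> U" and \<phi>: "smooth_on U \<phi>" and \<psi>: "smooth_on V \<psi>"
    and hom: "homeomorphism U V \<phi> \<psi>" and E: "subspace E" and slice: "\<phi> ` (M \<inter> U) = E \<inter> V"
  shows "tangent_space M x = frechet_derivative \<psi> (at (\<phi> x)) ` E"
proof (intro equalityI subsetI)
  have opn: "open U" "open V" using \<phi> \<psi> by (auto simp: smooth_on_def)
  have inv: "\<And>y. y \<in> U \<Longrightarrow> \<psi> (\<phi> y) = y" using hom by (auto simp: homeomorphism_def)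
  have \<phi>x: "\<phi> x \<in> E" "\<phi> x \<in> V" using slice x by auto
  let ?D = "frechet_derivative \<psi> (at (\<phi> x))"
  have D: "(\<psi> has_derivative ?D) (at (\<phi> x))"
    using smooth_on_differentiable[OF \<psi> \<phi>x(2)] by (rule has_derivative_frechet)
  {
    fix v assume "v \<in> tangent_space M x"
    then obtain \<epsilon> \<gamma> where \<gamma>: "\<epsilon> > 0" "\<gamma> ` {-\<epsilon><..<\<epsilon>} \<subseteq> M" "\<gamma> 0 = x"
      "(\<gamma> has_vector_derivative v) (at 0)"
      unfolding tangent_space_def by blast
    have "isCont \<gamma> 0" using \<gamma>(4) has_vector_derivative_continuous by blast
    then have "(\<gamma> \<longlongrightarrow> x) (nhds 0)" using \<gamma>(3)
      by (metis isCont_def tendsto_at_iff_tendsto_nhds)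
    then have ev: "\<forall>\<^sub>F s in nhds 0. \<gamma> s \<in> U"
      using topological_tendstoD opn(1) x(2) by blast
    moreover have "\<forall>\<^sub>F s in nhds 0. s \<in> {-\<epsilon><..<\<epsilon>}"
      using \<gamma>(1) by (intro eventually_nhds_in_open) auto
    ultimately have "\<forall>\<^sub>F s in nhds 0. (\<phi> \<circ> \<gamma>) s \<in> E"
      by eventually_elim (use \<gamma>(2) slice in \<open>unfold comp_def, blast\<close>)
    moreover have "(\<phi> has_derivative frechet_derivative \<phi> (at x)) (at x)"
      using smooth_on_differentiable[OF \<phi> x(2)] by (rule has_derivative_frechet)
    then have w: "((\<phi> \<circ> \<gamma>) has_vector_derivative frechet_derivative \<phi> (at x) v) (at 0)"
      using vector_derivative_diff_chain_within[OF \<gamma>(4)] \<gamma>(3) has_derivative_at_withinI by metis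
    ultimately have wE: "frechet_derivative \<phi> (at x) v \<in> E"
      using E vector_derivative_in_subspace by blast
    have "((\<psi> \<circ> (\<phi> \<circ> \<gamma>)) has_vector_derivative ?D (frechet_derivative \<phi> (at x) v)) (at 0)"
      using vector_derivative_diff_chain_within[OF w] D \<gamma>(3)
      by (metis comp_apply has_derivative_at_withinI)
    moreover have "\<forall>\<^sub>F s in nhds 0. (\<psi> \<circ> (\<phi> \<circ> \<gamma>)) s = \<gamma> s"
      using ev by eventually_elim (simp add: inv)
    \<comment> \<open>Near 0 the curve \<open>\<psi> \<circ> (\<phi> \<circ> \<gamma>)\<close> is
      \<open>\<gamma>\<close> itself, so its velocity must also be \<open>v\<close>.\<close>
    ultimately have "(\<gamma> has_vector_derivative ?D (frechet_derivative \<phi> (at x) v)) (at 0)"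
      using has_vector_derivative_cong_ev[of UNIV "\<psi> \<circ> (\<phi> \<circ> \<gamma>)" \<gamma> 0] inv x(2) \<gamma>(3) by simp
    with \<gamma>(4) have "v = ?D (frechet_derivative \<phi> (at x) v)"
      by (rule vector_derivative_unique_at)
    with wE show "v \<in> ?D ` E" by blast
  next
    fix v assume "v \<in> ?D ` E"
    then obtain w where w: "w \<in> E" "v = ?D w" by blast
    define \<gamma> where "\<gamma> s = \<psi> (\<phi> x + s *\<^sub>R w)" for s
    have "((\<lambda>s. \<phi> x + s *\<^sub>R w) \<longlongrightarrow> \<phi> x + 0 *\<^sub>R w) (nhds (0::real))"
      by (intro tendsto_intros filterlim_ident)
    then have "\<forall>\<^sub>F s in nhds (0::real). \<phi> x + s *\<^sub>R w \<in> V"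
      using topological_tendstoD opn(2) \<phi>x by fastforce
    then obtain \<epsilon> where \<epsilon>: "\<epsilon> > 0" "\<And>s. \<bar>s\<bar> < \<epsilon> \<Longrightarrow> \<phi> x + s *\<^sub>R w \<in> V"
      unfolding eventually_nhds_metric by (auto simp: dist_real_def)
    have "smooth_on {-\<epsilon><..<\<epsilon>} \<gamma>"
      using Ck_on_along_line[of "{-\<epsilon><..<\<epsilon>}" "\<phi> x" w V _ \<psi> 1] \<epsilon>(2) \<psi>
      by (auto simp: smooth_on_def \<gamma>_def[abs_def] abs_less_iff)
    moreover have "\<gamma> ` {-\<epsilon><..<\<epsilon>} \<subseteq> M"
    proof clarify
      fix s assume "s \<in> {-\<epsilon><..<\<epsilon>}"
      then have "\<phi> x + s *\<^sub>R w \<in> \<phi> ` (M \<inter> U)"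
        unfolding slice using \<epsilon>(2) E \<phi>x w by (auto simp: subspace_add subspace_scale)
      then obtain y where "y \<in> M" "y \<in> U" "\<phi> x + s *\<^sub>R w = \<phi> y"
        by blast
      then show "\<gamma> s \<in> M" by (simp add: \<gamma>_def inv)
    qed
    moreover have "\<gamma> 0 = x" by (simp add: \<gamma>_def inv x)
    moreover have "((\<lambda>s::real. \<phi> x + s *\<^sub>R w) has_vector_derivative w) (at 0)"
      by (auto intro!: derivative_eq_intros)
    then have "((\<psi> \<circ> (\<lambda>s. \<phi> x + s *\<^sub>R w)) has_vector_derivative ?D w) (at 0)"
      using D by (intro vector_derivative_diff_chain_within) (auto intro: has_derivative_at_withinI)
    then have "(\<gamma> has_vector_derivative v) (at 0)"
      by (simp add: \<gamma>_def[abs_def] o_def w)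
    ultimately show "v \<in> tangent_space M x"
      unfolding tangent_space_def using \<epsilon>(1) by blast
  }
qed

section \<open>Second-order estimates in a chart\<close>

lemma differentiable_locally_bounded_growth:
  assumes "f differentiable (at x)"
  shows "\<exists>K\<ge>0. \<forall>\<^sub>F y in nhds x. norm (f y - f x) \<le> K * norm (y - x)"
proof -
  obtain f' where f': "bounded_linear f'"
    and "\<And>e. e > 0 \<Longrightarrow> \<exists>d>0. \<forall>y. norm (y - x) < d \<longrightarrow> norm (f y - f x - f' (y - x)) \<le> e * norm (y - x)"
    using assms unfolding differentiable_def has_derivative_at_alt by blast
  from this(2)[of 1] obtain d where d: "d > 0"
    "\<And>y. norm (y - x) < d \<Longrightarrow> norm (f y - f x - f' (y - x)) \<le> norm (y - x)" by auto
  have "norm (f y - f x) \<le> (onorm f' + 1) * norm (y - x)" if "norm (y - x) < d" for y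
    using norm_triangle_ineq[of "f y - f x - f' (y - x)" "f' (y - x)"] d(2)[OF that]
      onorm[OF f', of "y - x"] by (simp add: algebra_simps)
  then show ?thesis
    using d(1) onorm_pos_le[OF f']
    by (intro exI[of _ "onorm f' + 1"]) (auto simp: eventually_nhds_metric dist_norm)
qed

text \<open>\<open>smooth_on\<close> controls only the derivatives in fixed directions. Their growth
  bounds on the finitely many basis vectors add up, by linearity in \<open>w\<close>, to a bound
  uniform in the direction.\<close>

lemma smooth_on_frechet_derivative_growth:
  fixes f :: "'a::euclidean_space \<Rightarrow> 'b::euclidean_space"
  assumes "smooth_on S f" "a \<in> S"
  shows "\<exists>K\<ge>0. \<forall>\<^sub>F y in nhds a. \<forall>w. norm (frechet_derivative f (at y) w - frechet_derivative f (at a) w)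
    \<le> K * norm (y - a) * norm w"
proof -
  let ?D = "\<lambda>y. frechet_derivative f (at y)"
  have "\<forall>b. \<exists>K\<ge>0. \<forall>\<^sub>F y in nhds a. norm (?D y b - ?D a b) \<le> K * norm (y - a)"
    using differentiable_locally_bounded_growth smooth_on_frechet_derivative_differentiable[OF assms]
    by blast
  from choice[OF this] obtain K where K: "\<And>b. K b \<ge> 0"
    "\<And>b. \<forall>\<^sub>F y in nhds a. norm (?D y b - ?D a b) \<le> K b * norm (y - a)" by blast
  have "\<forall>\<^sub>F y in nhds a. \<forall>b\<in>Basis. norm (?D y b - ?D a b) \<le> K b * norm (y - a)"
    using K(2) by (intro eventually_ball_finite) auto
  moreover have "\<forall>\<^sub>F y in nhds a. y \<in> S"
    using assms by (intro eventually_nhds_in_open) (auto simp: smooth_on_def)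
  ultimately have "\<forall>\<^sub>F y in nhds a. \<forall>w. norm (?D y w - ?D a w) \<le> sum K Basis * norm (y - a) * norm w"
  proof eventually_elim
    case (elim y)
    define L where "L w = ?D y w - ?D a w" for w
    have lin: "linear L"
      unfolding L_def using smooth_on_differentiable[OF assms(1)] elim(2) assms(2)
      by (intro linear_compose_sub) (auto intro: has_derivative_linear has_derivative_frechet)
    show ?case
    proof
      fix w
      have "L w = L (\<Sum>b\<in>Basis. (w \<bullet> b) *\<^sub>R b)" by (simp add: euclidean_representation)
      also have "\<dots> = (\<Sum>b\<in>Basis. (w \<bullet> b) *\<^sub>R L b)"
        by (simp add: linear_sum[OF lin] linear_cmul[OF lin])
      also have "norm \<dots> \<le> (\<Sum>b\<in>Basis. norm w * (K b * norm (y - a)))"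
        using elim(1) K(1) by (intro sum_norm_le) (auto simp: L_def intro!: mult_mono Basis_le_norm)
      finally show "norm (?D y w - ?D a w) \<le> sum K Basis * norm (y - a) * norm w"
        by (simp add: L_def sum_distrib_left sum_distrib_right mult_ac)
    qed
  qed
  then show ?thesis using K(1) by (intro exI[of _ "sum K Basis"]) (simp add: sum_nonneg)
qed

text \<open>Write \<open>y = \<psi> (\<phi> x + w)\<close> with \<open>w \<in> E\<close>. Since
  \<open>N\<close> is normal, the derivative of \<open>N \<bullet> \<psi>\<close> along
  \<open>w\<close> vanishes at \<open>\<phi> x\<close> and grows at most linearly, so the mean value
  theorem gives a bound quadratic in \<open>w\<close>; and \<open>norm w\<close> is at most a
  multiple of \<open>norm (y - x)\<close>.\<close>

lemma embedded_submanifold_normal_quadratic: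
  fixes M :: "'a::euclidean_space set"
  assumes x: "x \<in> M" "x \<in> U" and \<phi>: "smooth_on U \<phi>" and \<psi>: "smooth_on V \<psi>"
    and hom: "homeomorphism U V \<phi> \<psi>" and E: "subspace E" and slice: "\<phi> ` (M \<inter> U) = E \<inter> V"
    and N: "\<And>v. v \<in> tangent_space M x \<Longrightarrow> N \<bullet> v = 0"
  shows "\<exists>C\<ge>0. \<forall>\<^sub>F y in nhds x. y \<in> M \<longrightarrow> N \<bullet> (y - x) \<le> C * (norm (y - x))\<^sup>2"
proof -
  have opn: "open U" "open V" using \<phi> \<psi> by (auto simp: smooth_on_def)
  have inv: "\<And>y. y \<in> U \<Longrightarrow> \<psi> (\<phi> y) = y" using hom by (auto simp: homeomorphism_def)
  have \<phi>x: "\<phi> x \<in> E" "\<phi> x \<in> V" using slice x by auto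
  let ?D = "\<lambda>y. frechet_derivative \<psi> (at y)"
  have ND: "N \<bullet> ?D (\<phi> x) w = 0" if "w \<in> E" for w
    using N that unfolding tangent_space_chart[OF x \<phi> \<psi> hom E slice] by blast
  obtain K where K: "K \<ge> 0"
    "\<forall>\<^sub>F y in nhds (\<phi> x). \<forall>w. norm (?D y w - ?D (\<phi> x) w) \<le> K * norm (y - \<phi> x) * norm w"
    using smooth_on_frechet_derivative_growth[OF \<psi> \<phi>x(2)] by blast
  have "\<forall>\<^sub>F y in nhds (\<phi> x). y \<in> V"
    using opn(2) \<phi>x(2) by (rule eventually_nhds_in_open)
  with K(2) have "\<forall>\<^sub>F y in nhds (\<phi> x). y \<in> V \<and>
      (\<forall>w. norm (?D y w - ?D (\<phi> x) w) \<le> K * norm (y - \<phi> x) * norm w)"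
    by eventually_elim auto
  then obtain \<rho> where \<rho>: "\<rho> > 0" "\<And>y. dist y (\<phi> x) < \<rho> \<Longrightarrow> y \<in> V"
    "\<And>y w. dist y (\<phi> x) < \<rho> \<Longrightarrow> norm (?D y w - ?D (\<phi> x) w) \<le> K * norm (y - \<phi> x) * norm w"
    unfolding eventually_nhds_metric by blast
  have quad: "N \<bullet> (\<psi> (\<phi> x + w) - \<psi> (\<phi> x)) \<le> norm N * (K * (norm w)\<^sup>2)"
    if w: "w \<in> E" "norm w < \<rho>" for w
  proof -
    have near: "dist (\<phi> x + s *\<^sub>R w) (\<phi> x) < \<rho>" "norm (s *\<^sub>R w) \<le> norm w" if "0 \<le> s" "s \<le> 1" for s
      using mult_left_le_one_le[of "norm w" s] w that by (auto simp: dist_norm)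
    have "((\<lambda>s. N \<bullet> \<psi> (\<phi> x + s *\<^sub>R w)) has_derivative (\<lambda>v. N \<bullet> ?D (\<phi> x + s *\<^sub>R w) (v *\<^sub>R w)))
        (at s within {0..1})" if "0 \<le> s" "s \<le> 1" for s
    proof -
      have "(\<psi> has_derivative ?D (\<phi> x + s *\<^sub>R w)) (at (\<phi> x + s *\<^sub>R w))"
        using smooth_on_differentiable[OF \<psi>] \<rho>(2) near(1) that by (intro has_derivative_frechet) blast
      moreover have "((\<lambda>s. \<phi> x + s *\<^sub>R w) has_derivative (\<lambda>v. v *\<^sub>R w)) (at s within {0..1})"
        by (auto intro!: derivative_eq_intros)
      ultimately show ?thesis
        by (intro has_derivative_inner_right) (rule has_derivative_compose)
    qed
    from mvt_very_simple[OF zero_le_one this]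
    obtain s where s: "0 \<le> s" "s \<le> 1"
      "N \<bullet> \<psi> (\<phi> x + w) - N \<bullet> \<psi> (\<phi> x) = N \<bullet> ?D (\<phi> x + s *\<^sub>R w) w"
      by auto
    \<comment> \<open>Normality allows subtracting the derivative at \<open>\<phi> x\<close>, whose
      product with \<open>N\<close> is 0, so that the growth bound applies.\<close>
    have "N \<bullet> (\<psi> (\<phi> x + w) - \<psi> (\<phi> x)) = N \<bullet> (?D (\<phi> x + s *\<^sub>R w) w - ?D (\<phi> x) w)"
      using s(3) ND[OF w(1)] by (simp add: inner_diff_right)
    also have "\<dots> \<le> norm N * norm (?D (\<phi> x + s *\<^sub>R w) w - ?D (\<phi> x) w)"
      by (rule norm_cauchy_schwarz)
    also have "\<dots> \<le> norm N * (K * norm (s *\<^sub>R w) * norm w)"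
      using \<rho>(3)[OF near(1)[OF s(1,2)], of w] by (intro mult_left_mono) auto
    also have "\<dots> \<le> norm N * (K * norm w * norm w)"
      using near(2)[OF s(1,2)] K(1) by (intro mult_left_mono mult_right_mono) auto
    finally show ?thesis by (simp add: power2_eq_square mult_ac)
  qed
  obtain K' where K': "K' \<ge> 0" "\<forall>\<^sub>F y in nhds x. norm (\<phi> y - \<phi> x) \<le> K' * norm (y - x)"
    using differentiable_locally_bounded_growth[OF smooth_on_differentiable[OF \<phi> x(2)]] by blast
  have "isCont \<phi> x"
    using smooth_on_differentiable[OF \<phi> x(2)] differentiable_imp_continuous_within by blast
  then have "\<forall>\<^sub>F y in nhds x. dist (\<phi> y) (\<phi> x) < \<rho>"
    using \<rho>(1) by (auto simp: continuous_at_eps_delta eventually_nhds_metric)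
  moreover have "\<forall>\<^sub>F y in nhds x. y \<in> U"
    using opn(1) x(2) by (rule eventually_nhds_in_open)
  ultimately have "\<forall>\<^sub>F y in nhds x. y \<in> M \<longrightarrow> N \<bullet> (y - x) \<le> norm N * K * K'\<^sup>2 * (norm (y - x))\<^sup>2"
    using K'(2)
  proof eventually_elim
    case (elim y)
    show ?case
    proof
      assume "y \<in> M"
      then have "\<phi> y - \<phi> x \<in> E" using slice elim(2) \<phi>x E by (auto intro!: subspace_diff)
      from quad[OF this] elim have "N \<bullet> (y - x) \<le> norm N * (K * (norm (\<phi> y - \<phi> x))\<^sup>2)"
        by (simp add: inv x dist_norm)
      also have "\<dots> \<le> norm N * (K * (K' * norm (y - x))\<^sup>2)"
        using elim(3) K(1) by (intro mult_left_mono power_mono) auto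
      finally show "N \<bullet> (y - x) \<le> norm N * K * K'\<^sup>2 * (norm (y - x))\<^sup>2"
        by (simp add: power_mult_distrib mult_ac)
    qed
  qed
  then show ?thesis
    using K(1) by (intro exI[of _ "norm N * K * K'\<^sup>2"]) auto
qed

lemma norm_power2_scaleR_unit_diff:
  fixes N v :: "'a::real_inner"
  assumes "norm N = 1"
  shows "(norm (t *\<^sub>R N - v))\<^sup>2 = t\<^sup>2 - 2 * t * (N \<bullet> v) + (norm v)\<^sup>2"
proof -
  have "N \<bullet> N = 1" using assms by (simp add: norm_eq_1)
  then show ?thesis unfolding power2_norm_eq_inner
    by (simp add: inner_diff inner_commute[of v N] power2_eq_square[of t] algebra_simps)
qed

text \<open>Squaring shows that \<open>t \<le> norm (x + t *\<^sub>R N - y)\<close> amounts to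
  \<open>2 * t * (N \<bullet> (y - x)) \<le> (norm (y - x))\<^sup>2\<close>. A quadratic bound on
  all of \<open>M\<close> therefore suffices for small \<open>t\<close>.\<close>

lemma proximal_normal_of_quadratic:
  fixes M :: "'a::real_inner set"
  assumes R: "R > 0" and N: "norm N = 1" and C: "C \<ge> 0"
    and quad: "\<forall>\<^sub>F y in nhds x. y \<in> M \<longrightarrow> N \<bullet> (y - x) \<le> C * (norm (y - x))\<^sup>2"
  shows "\<exists>t>0. t < R \<and> (\<forall>y\<in>M. t \<le> norm (x + t *\<^sub>R N - y))"
proof -
  obtain \<delta> where \<delta>: "\<delta> > 0"
    "\<And>y. norm (y - x) < \<delta> \<Longrightarrow> y \<in> M \<Longrightarrow> N \<bullet> (y - x) \<le> C * (norm (y - x))\<^sup>2"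
    using quad unfolding eventually_nhds_metric by (auto simp: dist_norm)
  \<comment> \<open>\<open>C\<close> serves within distance \<open>\<delta>\<close> of
    \<open>x\<close>; farther away Cauchy-Schwarz gives the bound with
    \<open>1 / \<delta>\<close>.\<close>
  define K where "K = C + 1 / \<delta>"
  have K: "K > 0" "C \<le> K" "1 / \<delta> \<le> K"
    using C \<delta>(1) by (auto simp: K_def add_nonneg_pos)
  have le: "N \<bullet> (y - x) \<le> K * (norm (y - x))\<^sup>2" if "y \<in> M" for y
  proof (cases "norm (y - x) < \<delta>")
    case True
    with \<delta>(2) that have "N \<bullet> (y - x) \<le> C * (norm (y - x))\<^sup>2" by blast
    also have "\<dots> \<le> K * (norm (y - x))\<^sup>2" using K by (intro mult_right_mono) auto
    finally show ?thesis .
  next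
    case False
    have "N \<bullet> (y - x) \<le> norm (y - x) * 1"
      using norm_cauchy_schwarz[of N "y - x"] N by simp
    also have "\<dots> \<le> norm (y - x) * (1 / \<delta> * norm (y - x))"
      using False \<delta>(1) by (intro mult_left_mono) (auto simp: field_simps)
    also have "\<dots> = 1 / \<delta> * (norm (y - x))\<^sup>2" by (simp add: power2_eq_square)
    also have "\<dots> \<le> K * (norm (y - x))\<^sup>2" using K by (intro mult_right_mono) auto
    finally show ?thesis .
  qed
  define t where "t = min (R / 2) (1 / (2 * K))"
  have t: "0 < t" "t < R" "2 * t * K \<le> 1"
    using R K(1) by (auto simp: t_def min_def field_simps)
  have "t \<le> norm (x + t *\<^sub>R N - y)" if "y \<in> M" for y
  proof -
    have "2 * t * (N \<bullet> (y - x)) \<le> 2 * t * (K * (norm (y - x))\<^sup>2)"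
      using le[OF that] t by (intro mult_left_mono) auto
    also have "\<dots> \<le> (norm (y - x))\<^sup>2"
      using mult_right_mono[OF t(3), of "(norm (y - x))\<^sup>2"] by (simp add: mult_ac)
    finally have "2 * t * (N \<bullet> (y - x)) \<le> (norm (y - x))\<^sup>2" .
    moreover have "(norm (t *\<^sub>R N - (y - x)))\<^sup>2 = t\<^sup>2 - 2 * t * (N \<bullet> (y - x)) + (norm (y - x))\<^sup>2"
      using N by (rule norm_power2_scaleR_unit_diff)
    moreover have eq: "x + t *\<^sub>R N - y = t *\<^sub>R N - (y - x)" by simp
    ultimately have "t\<^sup>2 \<le> (norm (x + t *\<^sub>R N - y))\<^sup>2" unfolding eq by linarith
    then show ?thesis by (rule power2_le_imp_le) simp
  qed
  with t show ?thesis by blast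
qed

subsection \<open>Proximal smoothness\<close>

text \<open>The graph of \<open>P\<close> is the set of pairs in \<open>K \<times> S\<close> whose
  distance equals the distance to \<open>S\<close>. It is relatively closed, and a closed graph with
  values in a compact set means continuity.\<close>

lemma continuous_on_nearest_point:
  fixes S :: "'a::euclidean_space set"
  assumes "compact S" and "\<And>z. z \<in> K \<Longrightarrow> nearest_points S z = {P z}"
  shows "continuous_on K P"
proof -
  have near: "p = P z \<longleftrightarrow> p \<in> S \<and> dist z p = infdist z S" if "z \<in> K" for z p
    using assms(2)[OF that] by (auto simp: nearest_points_def dist_norm)
  have PS: "P z \<in> S" "dist z (P z) = infdist z S" if "z \<in> K" for z
    using near[OF that, of "P z"] by auto
  have eq: "(\<lambda>z. (z, P z)) ` K =
      (K \<times> S) \<inter> {p. dist (fst p) (snd p) = infdist (fst p) S}"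
    using PS near by auto
  have "closed {p. dist (fst p) (snd p) = infdist (fst p) S}"
    by (intro closed_Collect_eq continuous_intros)
  then have "closedin (top_of_set (K \<times> S)) ((\<lambda>z. (z, P z)) ` K)"
    unfolding eq by (rule closedin_closed_Int)
  moreover have "P \<in> K \<rightarrow> S" using PS by auto
  ultimately show ?thesis
    using continuous_closed_graph_eq[OF assms(1)] by blast
qed

text \<open>The projection \<open>P\<close> being continuous on the tube of radius \<open>R\<close>, Brouwer's theorem gives a point
  \<open>z\<close> at distance \<open>r - t\<close> from \<open>c = X + t N\<close> such that \<open>c\<close> lies on the segment from \<open>P z\<close> to \<open>z\<close>.
  Then \<open>P z\<close> is also nearest to \<open>c\<close>, so \<open>P z = X\<close> and \<open>z = X + r N\<close>.\<close>

lemma proximally_smooth_extend_normal: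
  fixes S :: "'a::euclidean_space set"
  assumes S: "compact S" "proximally_smooth R S" and X: "X \<in> S" and N: "norm N = 1"
    and t: "0 < t" "t < r" "r < R" and near: "\<And>Y. Y \<in> S \<Longrightarrow> t \<le> norm (X + t *\<^sub>R N - Y)"
    and Y: "Y \<in> S"
  shows "r \<le> norm (X + r *\<^sub>R N - Y)"
proof -
  define c where "c = X + t *\<^sub>R N"
  define \<epsilon> where "\<epsilon> = r - t"
  define P where "P z = the_elem (nearest_points S z)" for z
  have ne: "S \<noteq> {}" using X by auto
  have cX: "dist c X = t" using N t by (simp add: c_def dist_norm)
  have c: "infdist c S = t"
  proof (rule antisym)
    show "infdist c S \<le> t" using infdist_le[OF X, of c] cX by simp
    show "t \<le> infdist c S"
      unfolding infdist_def using ne near by (auto intro!: cINF_greatest simp: c_def dist_norm)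
  qed
  \<comment> \<open>Points of this ball have distance at most \<open>t + \<epsilon> = r < R\<close>
    to \<open>S\<close>.\<close>
  have P: "nearest_points S z = {P z}" if "z \<in> cball c \<epsilon>" for z
  proof -
    have "infdist z S < R"
      using infdist_triangle[of z S c] that c t by (auto simp: \<epsilon>_def dist_commute)
    then show ?thesis
      using S(2) ne by (simp add: proximally_smooth_def P_def is_singleton_the_elem)
  qed
  have PS: "P z \<in> S" "dist z (P z) = infdist z S" if "z \<in> cball c \<epsilon>" for z
    using P[OF that] by (auto simp: nearest_points_def dist_norm)
  have Pc: "P z \<noteq> c" if "z \<in> cball c \<epsilon>" for z
    using PS(1)[OF that] c t by auto
  \<comment> \<open>The point of the sphere of radius \<open>\<epsilon>\<close> about
    \<open>c\<close> lying opposite to \<open>P z\<close>; it is well defined because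
    \<open>c\<close> is not in \<open>S\<close>.\<close>
  define \<Phi> where "\<Phi> z = c + (\<epsilon> / norm (c - P z)) *\<^sub>R (c - P z)" for z
  have "continuous_on (cball c \<epsilon>) \<Phi>"
    unfolding \<Phi>_def
    by (intro continuous_intros continuous_on_nearest_point[OF S(1) P])
       (metis Pc norm_eq_zero right_minus_eq)+
  moreover have "\<Phi> \<in> cball c \<epsilon> \<rightarrow> cball c \<epsilon>"
    using Pc t by (auto simp: \<Phi>_def \<epsilon>_def dist_norm)
  ultimately obtain z where z: "z \<in> cball c \<epsilon>" and fix_z: "\<Phi> z = z"
    using brouwer[of "cball c \<epsilon>" \<Phi>] t by (auto simp: \<epsilon>_def)
  define d where "d = norm (c - P z)"
  have d: "d > 0" using Pc[OF z] by (simp add: d_def)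
  have zc: "z - c = (\<epsilon> / d) *\<^sub>R (c - P z)"
    using fix_z by (simp add: \<Phi>_def d_def algebra_simps)
  have "z - P z = (z - c) + (c - P z)" by simp
  also have "\<dots> = (\<epsilon> / d + 1) *\<^sub>R (c - P z)" by (simp add: zc algebra_simps)
  finally have "norm (z - P z) = (\<epsilon> / d + 1) * d"
    using d t by (simp add: d_def \<epsilon>_def)
  also have "\<dots> = \<epsilon> + d" using d by (simp add: distrib_right)
  finally have dz: "infdist z S = \<epsilon> + d"
    using PS(2)[OF z] by (simp add: dist_norm)
  have "dist z c = \<epsilon>" using d t by (simp add: dist_norm zc \<epsilon>_def) (simp add: d_def)
  \<comment> \<open>The distance to \<open>S\<close> drops by at most \<open>\<epsilon>\<close> from
    \<open>z\<close> to \<open>c\<close>, so \<open>P z\<close>, at distance \<open>d\<close> from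
    \<open>c\<close>, is nearest to \<open>c\<close>.\<close>
  then have "d \<le> infdist c S" using infdist_triangle[of z S c] dz by simp
  moreover have "infdist c S \<le> d"
    using infdist_le[OF PS(1)[OF z], of c] by (simp add: d_def dist_norm)
  ultimately have dc: "infdist c S = d" by simp
  have "P z \<in> nearest_points S c" "X \<in> nearest_points S c"
    using PS(1)[OF z] X cX c dc by (auto simp: nearest_points_def dist_norm d_def)
  then have PX: "P z = X" using P[of c] t by (auto simp: \<epsilon>_def)
  then have "c - P z = t *\<^sub>R N" "d = t" using c dc by (auto simp: c_def)
  with zc t(1) have "z - c = \<epsilon> *\<^sub>R N" by simp
  then have "z = X + r *\<^sub>R N" by (simp add: c_def \<epsilon>_def algebra_simps)
  moreover have "infdist z S = r" using dz \<open>d = t\<close> by (simp add: \<epsilon>_def)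
  ultimately show ?thesis using infdist_le[OF Y, of z] by (simp add: dist_norm)
qed

text \<open>Squaring the extended bound for radius \<open>r\<close> gives the inequality with
  \<open>r\<close> in place of \<open>R\<close>. The extension reaches only \<open>r < R\<close>,
  hence the limit from the left.\<close>

lemma proximally_smooth_normal_inequality:
  fixes S :: "'a::euclidean_space set"
  assumes S: "compact S" "proximally_smooth R S" and X: "X \<in> S" and N: "norm N = 1"
    and t: "0 < t" "t < R" and near: "\<And>Y. Y \<in> S \<Longrightarrow> t \<le> norm (X + t *\<^sub>R N - Y)"
    and Y: "Y \<in> S"
  shows "2 * R * (N \<bullet> (Y - X)) \<le> (norm (Y - X))\<^sup>2"
proof -
  have r: "2 * r * (N \<bullet> (Y - X)) \<le> (norm (Y - X))\<^sup>2" if "t < r" "r < R" for r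
  proof -
    have "r\<^sup>2 \<le> (norm (X + r *\<^sub>R N - Y))\<^sup>2"
      using proximally_smooth_extend_normal[OF S X N t(1) that near Y] t that
      by (intro power_mono) auto
    moreover have "X + r *\<^sub>R N - Y = r *\<^sub>R N - (Y - X)" by simp
    moreover have "(norm (r *\<^sub>R N - (Y - X)))\<^sup>2 = r\<^sup>2 - 2 * r * (N \<bullet> (Y - X)) + (norm (Y - X))\<^sup>2"
      using N by (rule norm_power2_scaleR_unit_diff)
    ultimately show ?thesis by simp
  qed
  have "((\<lambda>r. 2 * r * (N \<bullet> (Y - X))) \<longlongrightarrow> 2 * R * (N \<bullet> (Y - X))) (at_left R)"
    by (intro tendsto_intros)
  moreover have "\<forall>\<^sub>F r in at_left R. 2 * r * (N \<bullet> (Y - X)) \<le> (norm (Y - X))\<^sup>2"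
    using eventually_at_left_real[OF t(2)] by eventually_elim (use r in auto)
  ultimately show ?thesis
    by (intro tendsto_upperbound[where F = "at_left R"]) (auto simp: trivial_limit_at_left_real)
qed

section \<open>Normal inequality on the submanifold and conclusion\<close>

lemma closest_point_subspace_orthogonal:
  fixes T :: "'a::euclidean_space set"
  assumes T: "subspace T" and v: "v \<in> T"
  shows "(a - closest_point T a) \<bullet> v = 0"
proof -
  have T': "convex T" "closed T" "T \<noteq> {}"
    using T subspace_imp_convex closed_subspace subspace_0 by blast+
  let ?p = "closest_point T a"
  have p: "?p \<in> T" using T' closest_point_in_set by blast
  \<comment> \<open>The variational inequality of the projection, tested at \<open>?p + v\<close>
    and \<open>?p - v\<close>, bounds the product from both sides.\<close>
  have "(a - ?p) \<bullet> ((?p + v) - ?p) \<le> 0"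
    using closest_point_dot[OF T'(1,2) subspace_add[OF T p v]] .
  moreover have "(a - ?p) \<bullet> ((?p - v) - ?p) \<le> 0"
    using closest_point_dot[OF T'(1,2) subspace_diff[OF T p v]] .
  ultimately show ?thesis by simp
qed

text \<open>The chart supplies some constant \<open>C\<close> depending on the point, hence some
  radius \<open>t\<close>; proximal smoothness then replaces it by the uniform radius
  \<open>R\<close>. Scaling to a unit normal produces the factor \<open>norm W\<close>.\<close>

lemma proximally_smooth_submanifold_normal_inequality:
  fixes M :: "'a::euclidean_space set"
  assumes R: "R > 0" and M: "embedded_submanifold M" "compact M" "proximally_smooth R M"
    and X: "X \<in> M" and Y: "Y \<in> M" and W: "\<And>v. v \<in> tangent_space M X \<Longrightarrow> W \<bullet> v = 0"
  shows "W \<bullet> (Y - X) \<le> norm W / R / 2 * (norm (Y - X))\<^sup>2"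
proof (cases "W = 0")
  case False
  define N where "N = (1 / norm W) *\<^sub>R W"
  have N: "norm N = 1" "W = norm W *\<^sub>R N" using False by (auto simp: N_def)
  obtain U V E \<phi> \<psi> where chart: "X \<in> U" "smooth_on U \<phi>" "smooth_on V \<psi>"
    "homeomorphism U V \<phi> \<psi>" "subspace (E :: 'a set)" "\<phi> ` (M \<inter> U) = E \<inter> V"
    using M(1) X unfolding embedded_submanifold_def by metis
  have "N \<bullet> v = 0" if "v \<in> tangent_space M X" for v
    using W[OF that] by (simp add: N_def)
  from embedded_submanifold_normal_quadratic[OF X chart this]
  obtain C where "C \<ge> 0" "\<forall>\<^sub>F y in nhds X. y \<in> M \<longrightarrow> N \<bullet> (y - X) \<le> C * (norm (y - X))\<^sup>2"
    by blast
  from proximal_normal_of_quadratic[OF R N(1) this]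
  obtain t where "0 < t" "t < R" "\<And>y. y \<in> M \<Longrightarrow> t \<le> norm (X + t *\<^sub>R N - y)" by blast
  from proximally_smooth_normal_inequality[OF M(2,3) X N(1) this Y]
  have "N \<bullet> (Y - X) \<le> (norm (Y - X))\<^sup>2 / (2 * R)" using R by (simp add: field_simps)
  then have "norm W * (N \<bullet> (Y - X)) \<le> norm W * ((norm (Y - X))\<^sup>2 / (2 * R))"
    by (intro mult_left_mono) auto
  moreover have "W \<bullet> (Y - X) = norm W * (N \<bullet> (Y - X))"
    by (subst N(2)) simp
  ultimately show ?thesis by (simp add: mult_ac)
qed simp

text \<open>This makes \<open>closest_point\<close> on the tangent space the orthogonal
  projection.\<close>

lemma subspace_tangent_space:
  fixes M :: "'a::euclidean_space set"
  assumes "embedded_submanifold M" "X \<in> M"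
  shows "subspace (tangent_space M X)"
proof -
  obtain U V E \<phi> \<psi> where chart: "X \<in> U" "smooth_on U \<phi>" "smooth_on V \<psi>"
    "homeomorphism U V \<phi> \<psi>" "subspace (E :: 'a set)" "\<phi> ` (M \<inter> U) = E \<inter> V"
    using assms unfolding embedded_submanifold_def by metis
  have "\<phi> X \<in> V" using chart assms(2) by blast
  then have "linear (frechet_derivative \<psi> (at (\<phi> X)))"
    using smooth_on_differentiable[OF chart(3)] has_derivative_frechet has_derivative_linear by blast
  then show ?thesis
    unfolding tangent_space_chart[OF assms(2) chart] using chart(5) linear_subspace_image by blast
qed

theorem lemma4p1:
  fixes R \<tau> :: real
    and M U :: "(real ^ 'p ^ 'n) set"
    and h :: "real ^ 'p ^ 'n \<Rightarrow> real"
  assumes "R > 0"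
    and "embedded_submanifold M" and "compact M" and "proximally_smooth R M"
    and "weakly_convex \<tau> h"
    and "bounded U" and "convex U" and "M \<subseteq> interior U"
  shows "\<exists>L>0. L-lipschitz_on U h \<and>
    (\<forall>X\<in>M. \<forall>Y\<in>M. \<forall>G\<in>clarke_subdifferential h X. \<forall>GM.
       GM = closest_point (tangent_space M X) G \<longrightarrow>
         GM \<in> riemannian_clarke_subdifferential M h X \<and>
         h Y \<ge> h X + GM \<bullet> (Y - X) - (\<tau> + norm G / R) / 2 * (norm (Y - X))\<^sup>2 \<and>
         h X + GM \<bullet> (Y - X) - (\<tau> + norm G / R) / 2 * (norm (Y - X))\<^sup>2
           \<ge> h X + GM \<bullet> (Y - X) - (\<tau> + L / R) / 2 * (norm (Y - X))\<^sup>2)"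
proof -
  obtain L where L: "L > 0" "L-lipschitz_on U h"
    using weakly_convex_lipschitz_on_bounded assms(5,6) by blast
  show ?thesis
  proof (intro exI[of _ L] conjI L ballI allI impI)
    fix X Y G GM
    assume X: "X \<in> M" and Y: "Y \<in> M" and G: "G \<in> clarke_subdifferential h X"
      and GM: "GM = closest_point (tangent_space M X) G"
    let ?d = "(norm (Y - X))\<^sup>2"
    show "GM \<in> riemannian_clarke_subdifferential M h X"
      using G GM by (simp add: riemannian_clarke_subdifferential_def)
    have T: "subspace (tangent_space M X)"
      using assms(2) X by (rule subspace_tangent_space)
    \<comment> \<open>With this sign of the normal part, an upper bound on its product with
      \<open>Y - X\<close> is a lower bound for \<open>G \<bullet> (Y - X)\<close> in terms of
      \<open>GM\<close>.\<close>
    have orth: "(GM - G) \<bullet> v = 0" if "v \<in> tangent_space M X" for v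
      using closest_point_subspace_orthogonal[OF T that, of G] by (simp add: GM inner_diff_left)
    \<comment> \<open>The origin is a competitor in the projection onto the tangent space.\<close>
    have "norm (GM - G) \<le> norm G"
      using closest_point_le[OF closed_subspace[OF T] subspace_0[OF T], of G]
      by (simp add: GM dist_norm norm_minus_commute)
    have "(GM - G) \<bullet> (Y - X) \<le> norm (GM - G) / R / 2 * ?d"
      using assms(1-4) X Y orth by (rule proximally_smooth_submanifold_normal_inequality)
    also have "\<dots> \<le> norm G / R / 2 * ?d"
      using \<open>norm (GM - G) \<le> norm G\<close> assms(1) by (intro mult_right_mono divide_right_mono) auto
    finally show "h Y \<ge> h X + GM \<bullet> (Y - X) - (\<tau> + norm G / R) / 2 * ?d"
      using weakly_convex_clarke_subgradient[OF assms(5) G, of Y]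
      by (simp add: inner_diff_left add_divide_distrib distrib_right)
    \<comment> \<open>The Lipschitz constant bounds subgradients at interior points of
      \<open>U\<close>, in particular on \<open>M\<close>.\<close>
    have "norm G \<le> L"
      using norm_clarke_subgradient_le[OF L(2) _ G] X assms(8) by blast
    then have "(\<tau> + norm G / R) / 2 * ?d \<le> (\<tau> + L / R) / 2 * ?d"
      using assms(1) by (intro mult_right_mono divide_right_mono add_left_mono) auto
    then show "h X + GM \<bullet> (Y - X) - (\<tau> + norm G / R) / 2 * ?d
        \<ge> h X + GM \<bullet> (Y - X) - (\<tau> + L / R) / 2 * ?d" by simp
  qed
qed

end
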